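(* Let $n$ be a positive integer, let $a_1,\dots,a_n\in\mathbb{C}$, and let $A_n$ be the finite rank operator on $A^2(\mathbb{D})$ given by $A_n(f)=\sum_{i=1}^{n}\langle f,a_iz^i\rangle a_iz^i$ for $f\in A^2(\mathbb{D})$. Then the Berezin range $\mathrm{Ber}(A_n)$ is convex in $\mathbb{C}$.
   Context: $\mathbb{D}$ is the open unit disc in $\mathbb{C}$. $A^2(\mathbb{D})$ is the Bergman space of holomorphic functions $f$ on $\mathbb{D}$ with $\int_{\mathbb{D}}|f(z)|^2\,dV(z)<\infty$, where $dV$ is the normalized area measure on $\mathbb{D}$, with inner product $\langle f,g\rangle=\int_{\mathbb{D}}f(z)\overline{g(z)}\,dV(z)$. It is a reproducing kernel Hilbert space with reproducing kernel $k_\lambda(z)=\frac{1}{(1-\bar\lambda z)^2}$ at $\lambda\in\mathbb{D}$, and $\hat{k}_\lambda=k_\lambda/\|k_\lambda\|$ is the normalized reproducing kernel. $z^i$ denotes the function $z\mapsto z^i$. For a bounded linear operator $T$ on $A^2(\mathbb{D})$, the Berezin transform is $\widetilde{T}(\lambda)=\langle T\hat{k}_\lambda,\hat{k}_\lambda\rangle$ for $\lambda\in\mathbb{D}$, and the Berezin range is $\mathrm{Ber}(T)=\{\widetilde{T}(\lambda):\lambda\in\mathbb{D}\}$. *)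

theory Defs
  imports "HOL-Analysis.Analysis"
begin

definition unit_disc :: "complex set" where
  "unit_disc = ball 0 1"

text \<open>The measure space of the normalized area measure is the disc itself, so neither
  measurability nor integrability of a function depends on its values outside the disc.\<close>

definition disc_area :: "complex measure" where
  "disc_area = uniform_measure (restrict_space lborel unit_disc) unit_disc"

text \<open>A function on the disc is represented by any total function with the right values on the
  disc; membership in the space and the inner product depend only on these values.\<close>

definition bergman_space :: "(complex \<Rightarrow> complex) set" where
  "bergman_space =
    {f. f holomorphic_on unit_disc \<and> integrable disc_area (\<lambda>z. (norm (f z))\<^sup>2)}"

definition bergman_inner :: "(complex \<Rightarrow> complex) \<Rightarrow> (complex \<Rightarrow> complex) \<Rightarrow> complex" where
  "bergman_inner f g = (LINT z|disc_area. f z * cnj (g z))"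

definition bergman_norm :: "(complex \<Rightarrow> complex) \<Rightarrow> real" where
  "bergman_norm f = sqrt (Re (bergman_inner f f))"

definition bergman_kernel :: "complex \<Rightarrow> complex \<Rightarrow> complex" where
  "bergman_kernel \<zeta> z = 1 / (1 - cnj \<zeta> * z)\<^sup>2"

definition normalized_kernel :: "complex \<Rightarrow> complex \<Rightarrow> complex" where
  "normalized_kernel \<zeta> z = bergman_kernel \<zeta> z / complex_of_real (bergman_norm (bergman_kernel \<zeta>))"

definition berezin_transform ::
    "((complex \<Rightarrow> complex) \<Rightarrow> (complex \<Rightarrow> complex)) \<Rightarrow> complex \<Rightarrow> complex" where
  "berezin_transform T \<zeta> = bergman_inner (T (normalized_kernel \<zeta>)) (normalized_kernel \<zeta>)"

definition berezin_range ::
    "((complex \<Rightarrow> complex) \<Rightarrow> (complex \<Rightarrow> complex)) \<Rightarrow> complex set" where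
  "berezin_range T = berezin_transform T ` unit_disc"

end

theory Submission
  imports Defs "HOL-Probability.Probability_Measure"
begin

text \<open>
  Let \<open>c\<^sub>i(\<zeta>)\<close> be the inner product of the normalized kernel at \<open>\<zeta>\<close> with \<open>a\<^sub>i z\<^sup>i\<close>. Applying the
  operator to the normalized kernel and pairing with that kernel again gives
  \<open>\<Sum>i. c\<^sub>i(\<zeta>) * cnj (c\<^sub>i(\<zeta>)) = \<Sum>i. \<bar>c\<^sub>i(\<zeta>)\<bar>\<^sup>2\<close>: the operator is positive, so its
  Berezin transform is real. A continuous real function on the connected disc has an interval
  as its range, and an interval on the real axis is convex in the plane.

  Reality of the transform is \<open>berezin_transform_diagonal_operator\<close>. Its continuity can
  be read off the integrals that define it: the pairings of the kernel with the \<open>a\<^sub>i z\<^sup>i\<close> and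
  the squared norm of the kernel are integrals over the disc whose integrands depend
  continuously on \<open>\<zeta>\<close> and are bounded uniformly while \<open>\<zeta>\<close> stays in a smaller closed disc,
  so dominated convergence applies (\<open>continuous_on_disc_area_integral\<close>). The norm by
  which one divides is positive because the kernel is bounded away from zero on the disc.
\<close>

section \<open>Integration over the disc\<close>

lemma mem_unit_disc: "z \<in> unit_disc \<longleftrightarrow> norm z < 1"
  by (simp add: unit_disc_def)

lemma space_disc_area: "space disc_area = unit_disc"
  by (simp add: disc_area_def space_restrict_space)

lemma prob_space_disc_area: "prob_space disc_area"
proof -
  have em: "emeasure (restrict_space lborel unit_disc) unit_disc = emeasure lborel unit_disc"
    by (subst emeasure_restrict_space) (auto simp: unit_disc_def)
  have "emeasure lborel unit_disc \<noteq> 0"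
    unfolding unit_disc_def
    using open_not_negligible[of "ball (0::complex) 1"] 
    by (auto simp: negligible_iff_null_sets null_sets_completion_iff null_sets_def)
  moreover have "emeasure lborel unit_disc \<noteq> \<infinity>"
    unfolding unit_disc_def using emeasure_lborel_ball_finite[of "0::complex" 1] by simp
  ultimately show ?thesis
    unfolding disc_area_def using em by (intro prob_space_uniform_measure) auto
qed

lemma continuous_on_unit_disc_measurable:
  fixes f :: "complex \<Rightarrow> 'b::topological_space"
  assumes "continuous_on unit_disc f"
  shows "f \<in> borel_measurable disc_area"
proof -
  have "sets disc_area = sets (restrict_space borel unit_disc)"
    unfolding disc_area_def by (simp add: sets_restrict_space)
  then show ?thesis
    using borel_measurable_continuous_on_restrict[OF assms] measurable_cong_sets by blast
qed

lemma bounded_continuous_integrable_disc_area: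
  fixes f :: "complex \<Rightarrow> 'b::{banach, second_countable_topology}"
  assumes "continuous_on unit_disc f" and "\<And>z. z \<in> unit_disc \<Longrightarrow> norm (f z) \<le> B"
  shows "integrable disc_area f"
proof -
  interpret prob_space disc_area by (rule prob_space_disc_area)
  show ?thesis
    by (rule integrable_const_bound[of _ B])
       (auto intro!: AE_I2 assms continuous_on_unit_disc_measurable simp: space_disc_area)
qed

text \<open>
  A bound uniform over each smaller closed disc suffices: a sequence in the open disc that
  converges in it is, together with its limit, compact and so stays in such a disc.
\<close>

lemma continuous_on_disc_area_integral:
  fixes F :: "complex \<Rightarrow> complex \<Rightarrow> 'b::{banach, second_countable_topology}"
  assumes cont_z: "\<And>\<zeta>. \<zeta> \<in> unit_disc \<Longrightarrow> continuous_on unit_disc (F \<zeta>)"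
    and cont_\<zeta>: "\<And>z. z \<in> unit_disc \<Longrightarrow> continuous_on unit_disc (\<lambda>\<zeta>. F \<zeta> z)"
    and bound: "\<And>r. r < 1 \<Longrightarrow> \<exists>B. \<forall>\<zeta>\<in>cball 0 r. \<forall>z\<in>unit_disc. norm (F \<zeta> z) \<le> B"
  shows "continuous_on unit_disc (\<lambda>\<zeta>. LINT z|disc_area. F \<zeta> z)"
proof (rule continuous_on_sequentiallyI)
  interpret prob_space disc_area by (rule prob_space_disc_area)
  fix u \<zeta> assume u: "\<forall>n. u n \<in> unit_disc" and \<zeta>: "\<zeta> \<in> unit_disc" and lim: "u \<longlonglongrightarrow> \<zeta>"
  have "compact (insert \<zeta> (range u))"
    using lim by (rule compact_sequence_with_limit)
  then have "compact (norm ` insert \<zeta> (range u))"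
    by (intro compact_continuous_image continuous_intros)
  then obtain w where w: "w \<in> insert \<zeta> (range u)"
      and max: "\<And>x. x \<in> insert \<zeta> (range u) \<Longrightarrow> norm x \<le> norm w"
    using compact_attains_sup[of "norm ` insert \<zeta> (range u)"] by blast
  have "norm w < 1" using w u \<zeta> by (auto simp: mem_unit_disc)
  then obtain B where B: "\<And>x z. norm x \<le> norm w \<Longrightarrow> z \<in> unit_disc \<Longrightarrow> norm (F x z) \<le> B"
    using bound[of "norm w"] unfolding Ball_def mem_cball_0 by blast
  show "(\<lambda>n. LINT z|disc_area. F (u n) z) \<longlonglongrightarrow> (LINT z|disc_area. F \<zeta> z)"
  proof (rule integral_dominated_convergence[where w = "\<lambda>_. B"])
    show "F \<zeta> \<in> borel_measurable disc_area" "\<And>n. F (u n) \<in> borel_measurable disc_area"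
      using u \<zeta> cont_z by (auto intro: continuous_on_unit_disc_measurable)
    show "AE z in disc_area. (\<lambda>n. F (u n) z) \<longlonglongrightarrow> F \<zeta> z"
      by (rule AE_I2, rule continuous_on_tendsto_compose[OF cont_\<zeta> lim \<zeta>])
         (use u in \<open>auto simp: space_disc_area\<close>)
    show "AE z in disc_area. norm (F (u n) z) \<le> B" for n
      by (rule AE_I2) (use B max in \<open>auto simp: space_disc_area\<close>)
  qed simp
qed

lemma bergman_inner_cong:
  assumes "\<And>z. z \<in> unit_disc \<Longrightarrow> f z = g z"
  shows "bergman_inner f h = bergman_inner g h"
  unfolding bergman_inner_def
  by (rule Bochner_Integration.integral_cong) (auto simp: space_disc_area assms)

lemma bergman_inner_commute: "bergman_inner g f = cnj (bergman_inner f g)"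
  by (simp add: bergman_inner_def mult.commute flip: Bochner_Integration.integral_cnj)

section \<open>The kernel\<close>

lemma norm_kernel_denominator:
  assumes "norm \<zeta> \<le> r" "r < 1" "z \<in> unit_disc"
  shows "1 - r \<le> norm (1 - cnj \<zeta> * z)" and "norm (1 - cnj \<zeta> * z) \<le> 2"
proof -
  have "norm (cnj \<zeta> * z) \<le> r * 1"
    unfolding norm_mult by (rule mult_mono) (use assms in \<open>auto simp: mem_unit_disc intro: order_trans[OF norm_ge_zero]\<close>)
  then show "1 - r \<le> norm (1 - cnj \<zeta> * z)" "norm (1 - cnj \<zeta> * z) \<le> 2"
    using norm_triangle_ineq2[of 1 "cnj \<zeta> * z"] norm_triangle_ineq4[of 1 "cnj \<zeta> * z"] assms by auto
qed

lemma norm_bergman_kernel_upper: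
  assumes "norm \<zeta> \<le> r" "r < 1" "z \<in> unit_disc"
  shows "norm (bergman_kernel \<zeta> z) \<le> 1 / (1 - r)\<^sup>2"
  unfolding bergman_kernel_def norm_divide norm_power
  using norm_kernel_denominator(1)[OF assms] assms(2) by (simp add: frac_le power_mono)

lemma kernel_denominator_nonzero:
  assumes "\<zeta> \<in> unit_disc" "z \<in> unit_disc"
  shows "1 - cnj \<zeta> * z \<noteq> 0"
  using norm_kernel_denominator(1)[of \<zeta> "norm \<zeta>" z] assms by (auto simp: mem_unit_disc)

lemma norm_bergman_kernel_lower:
  assumes "\<zeta> \<in> unit_disc" "z \<in> unit_disc"
  shows "1 / 4 \<le> norm (bergman_kernel \<zeta> z)"
proof -
  have "(norm (1 - cnj \<zeta> * z))\<^sup>2 \<le> 2\<^sup>2"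
    using norm_kernel_denominator(2)[of \<zeta> "norm \<zeta>" z] assms 
    by (intro power_mono) (auto simp: mem_unit_disc)
  then show ?thesis
    unfolding bergman_kernel_def norm_divide norm_power
    using kernel_denominator_nonzero[OF assms] by (simp add: field_simps)
qed

lemma continuous_on_bergman_kernel:
  assumes "\<zeta> \<in> unit_disc"
  shows "continuous_on unit_disc (bergman_kernel \<zeta>)"
  unfolding bergman_kernel_def[abs_def]
  by (intro continuous_intros) (use kernel_denominator_nonzero assms in auto)

lemma continuous_on_bergman_kernel_parameter:
  assumes "z \<in> unit_disc"
  shows "continuous_on unit_disc (\<lambda>\<zeta>. bergman_kernel \<zeta> z)"
  unfolding bergman_kernel_def
  by (intro continuous_intros) (use kernel_denominator_nonzero assms in auto)

lemma continuous_on_bergman_inner_kernel: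
  assumes "continuous_on unit_disc g" and "\<And>z. z \<in> unit_disc \<Longrightarrow> norm (g z) \<le> C"
  shows "continuous_on unit_disc (\<lambda>\<zeta>. bergman_inner (bergman_kernel \<zeta>) g)"
  unfolding bergman_inner_def
proof (rule continuous_on_disc_area_integral)
  fix r :: real assume r: "r < 1"
  have "norm (bergman_kernel \<zeta> z * cnj (g z)) \<le> 1 / (1 - r)\<^sup>2 * C"
    if "\<zeta> \<in> cball 0 r" "z \<in> unit_disc" for \<zeta> z
    unfolding norm_mult using that r assms(2)[of z]
    by (intro mult_mono norm_bergman_kernel_upper) (auto simp: dist_norm)
  then show "\<exists>B. \<forall>\<zeta>\<in>cball 0 r. \<forall>z\<in>unit_disc. norm (bergman_kernel \<zeta> z * cnj (g z)) \<le> B"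
    by blast
qed (auto intro!: continuous_intros assms continuous_on_bergman_kernel continuous_on_bergman_kernel_parameter)

lemma bergman_norm_kernel:
  "bergman_norm (bergman_kernel \<zeta>) = sqrt (LINT z|disc_area. (norm (bergman_kernel \<zeta> z))\<^sup>2)"
proof -
  have "bergman_inner (bergman_kernel \<zeta>) (bergman_kernel \<zeta>)
      = (LINT z|disc_area. complex_of_real ((norm (bergman_kernel \<zeta> z))\<^sup>2))"
    unfolding bergman_inner_def complex_norm_square ..
  then show ?thesis
    unfolding bergman_norm_def by (simp only: integral_complex_of_real Re_complex_of_real)
qed

lemma integrable_norm_kernel_power2:
  assumes "\<zeta> \<in> unit_disc"
  shows "integrable disc_area (\<lambda>z. (norm (bergman_kernel \<zeta> z))\<^sup>2)"
  by (rule bounded_continuous_integrable_disc_area[where B = "(1 / (1 - norm \<zeta>)\<^sup>2)\<^sup>2"])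
     (auto intro!: continuous_intros continuous_on_bergman_kernel assms power_mono
        norm_bergman_kernel_upper simp del: power_divide power_one,
      use assms in \<open>auto simp: mem_unit_disc\<close>)

lemma bergman_norm_kernel_pos:
  assumes "\<zeta> \<in> unit_disc"
  shows "bergman_norm (bergman_kernel \<zeta>) > 0"
proof -
  interpret prob_space disc_area by (rule prob_space_disc_area)
  have "(1 / 4 :: real)\<^sup>2 = (LINT z|disc_area. (1 / 4)\<^sup>2)"
    by (simp add: prob_space)
  also have "\<dots> \<le> (LINT z|disc_area. (norm (bergman_kernel \<zeta> z))\<^sup>2)"
    using integrable_norm_kernel_power2[OF assms] norm_bergman_kernel_lower[OF assms]
    by (intro integral_mono power_mono) (auto simp: space_disc_area)
  finally show ?thesis
    unfolding bergman_norm_kernel by (simp add: power2_eq_square)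
qed

lemma continuous_on_bergman_norm_kernel:
  "continuous_on unit_disc (\<lambda>\<zeta>. bergman_norm (bergman_kernel \<zeta>))"
  unfolding bergman_norm_kernel
proof (intro continuous_on_real_sqrt continuous_on_disc_area_integral)
  fix r :: real assume r: "r < 1"
  have "norm ((norm (bergman_kernel \<zeta> z))\<^sup>2) \<le> (1 / (1 - r)\<^sup>2)\<^sup>2"
    if "\<zeta> \<in> cball 0 r" "z \<in> unit_disc" for \<zeta> z
    using power_mono[OF norm_bergman_kernel_upper[of \<zeta> r z], of 2] that r by simp
  then show "\<exists>B. \<forall>\<zeta>\<in>cball 0 r. \<forall>z\<in>unit_disc. norm ((norm (bergman_kernel \<zeta> z))\<^sup>2) \<le> B"
    by blast
qed (auto intro!: continuous_intros continuous_on_bergman_kernel continuous_on_bergman_kernel_parameter)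

lemma continuous_on_normalized_kernel:
  assumes "\<zeta> \<in> unit_disc"
  shows "continuous_on unit_disc (normalized_kernel \<zeta>)"
  unfolding normalized_kernel_def[abs_def]
  by (intro continuous_intros continuous_on_bergman_kernel assms)
     (use bergman_norm_kernel_pos[OF assms] in auto)

lemma norm_normalized_kernel_le:
  assumes "\<zeta> \<in> unit_disc" "z \<in> unit_disc"
  shows "norm (normalized_kernel \<zeta> z)
    \<le> 1 / (1 - norm \<zeta>)\<^sup>2 / bergman_norm (bergman_kernel \<zeta>)"
  unfolding normalized_kernel_def norm_divide
  using norm_bergman_kernel_upper[of \<zeta> "norm \<zeta>" z] bergman_norm_kernel_pos[OF assms(1)] assms
  by (simp add: mem_unit_disc divide_right_mono del: divide_divide_eq_left)

lemma normalized_kernel_in_bergman_space: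
  assumes "\<zeta> \<in> unit_disc"
  shows "normalized_kernel \<zeta> \<in> bergman_space"
proof -
  have "normalized_kernel \<zeta> holomorphic_on unit_disc"
    unfolding normalized_kernel_def[abs_def] bergman_kernel_def
    by (intro holomorphic_intros)
       (use kernel_denominator_nonzero[OF assms] bergman_norm_kernel_pos[OF assms] in
         \<open>auto simp: bergman_kernel_def[abs_def]\<close>)
  moreover have "integrable disc_area (\<lambda>z. (norm (normalized_kernel \<zeta> z))\<^sup>2)"
    unfolding normalized_kernel_def norm_divide power_divide
    using integrable_norm_kernel_power2[OF assms] by simp
  ultimately show ?thesis
    by (simp add: bergman_space_def)
qed

lemma continuous_on_bergman_inner_normalized_kernel:
  assumes "continuous_on unit_disc g" and "\<And>z. z \<in> unit_disc \<Longrightarrow> norm (g z) \<le> C"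
  shows "continuous_on unit_disc (\<lambda>\<zeta>. bergman_inner (normalized_kernel \<zeta>) g)"
proof -
  have "bergman_inner (normalized_kernel \<zeta>) g
      = bergman_inner (bergman_kernel \<zeta>) g / of_real (bergman_norm (bergman_kernel \<zeta>))" for \<zeta>
    unfolding bergman_inner_def normalized_kernel_def by simp
  then show ?thesis
    using bergman_norm_kernel_pos
    by (auto intro!: continuous_intros continuous_on_bergman_inner_kernel[OF assms]
          continuous_on_bergman_norm_kernel)
       (metis less_irrefl)
qed

section \<open>The Berezin transform\<close>

text \<open>
  The second factor of each term of the operator, paired with the kernel, is the conjugate of
  the first one; hence the terms are squared moduli. The bounds on the functions \<open>g i\<close> make
  the products with the kernel integrable, so that the integral may be taken term by term.
\<close>

lemma berezin_transform_diagonal_operator: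
  assumes cont: "\<And>i. i \<in> I \<Longrightarrow> continuous_on unit_disc (g i)"
    and bound: "\<And>i z. i \<in> I \<Longrightarrow> z \<in> unit_disc \<Longrightarrow> norm (g i z) \<le> C i"
    and T: "\<And>f z. f \<in> bergman_space \<Longrightarrow> z \<in> unit_disc \<Longrightarrow>
              T f z = (\<Sum>i\<in>I. bergman_inner f (g i) * g i z)"
    and \<zeta>: "\<zeta> \<in> unit_disc"
  shows "berezin_transform T \<zeta>
    = of_real (\<Sum>i\<in>I. (norm (bergman_inner (normalized_kernel \<zeta>) (g i)))\<^sup>2)"
proof -
  let ?k = "normalized_kernel \<zeta>"
  let ?c = "\<lambda>i. bergman_inner ?k (g i)"
  let ?B = "1 / (1 - norm \<zeta>)\<^sup>2 / bergman_norm (bergman_kernel \<zeta>)"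
  have int: "integrable disc_area (\<lambda>z. g i z * cnj (?k z))" if "i \<in> I" for i
  proof (rule bounded_continuous_integrable_disc_area)
    show "continuous_on unit_disc (\<lambda>z. g i z * cnj (?k z))"
      using that by (intro continuous_intros cont continuous_on_normalized_kernel \<zeta>)
    show "norm (g i z * cnj (?k z)) \<le> C i * ?B" if z: "z \<in> unit_disc" for z
      unfolding norm_mult complex_mod_cnj
      using bound[OF \<open>i \<in> I\<close> z] norm_normalized_kernel_le[OF \<zeta> z]
      by (intro mult_mono) (auto intro: order_trans[OF norm_ge_zero])
  qed
  have "berezin_transform T \<zeta> = bergman_inner (\<lambda>z. \<Sum>i\<in>I. ?c i * g i z) ?k"
    unfolding berezin_transform_def
    by (intro bergman_inner_cong T normalized_kernel_in_bergman_space \<zeta>)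
  also have "\<dots> = (LINT z|disc_area. (\<Sum>i\<in>I. ?c i * (g i z * cnj (?k z))))"
    unfolding bergman_inner_def by (simp add: sum_distrib_right mult.assoc)
  also have "\<dots> = (\<Sum>i\<in>I. ?c i * bergman_inner (g i) ?k)"
    unfolding bergman_inner_def[of "g _"]
    by (subst Bochner_Integration.integral_sum) (use int in auto)
  also have "\<dots> = (\<Sum>i\<in>I. of_real ((norm (?c i))\<^sup>2))"
    by (simp add: bergman_inner_commute[of "g _"] complex_norm_square del: of_real_power)
  finally show ?thesis by simp
qed

theorem theorem3p3:
  fixes n :: nat
    and a :: "nat \<Rightarrow> complex"
    and A :: "(complex \<Rightarrow> complex) \<Rightarrow> (complex \<Rightarrow> complex)"
  assumes "n \<ge> 1"
    and "\<And>f z. f \<in> bergman_space \<Longrightarrow> z \<in> unit_disc \<Longrightarrow>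
           A f z = (\<Sum>i=1..n. bergman_inner f (\<lambda>w. a i * w ^ i) * (a i * z ^ i))"
  shows "convex (berezin_range A)"
proof -
  define g where "g = (\<lambda>i w. a i * w ^ i)"
  define \<phi> where "\<phi> = (\<lambda>\<zeta>. \<Sum>i=1..n. (norm (bergman_inner (normalized_kernel \<zeta>) (g i)))\<^sup>2)"
  have cont: "continuous_on unit_disc (g i)" for i
    unfolding g_def by (intro continuous_intros)
  have bound: "norm (g i z) \<le> norm (a i)" if "z \<in> unit_disc" for i z
    using that by (simp add: g_def norm_mult norm_power mem_unit_disc mult_left_le power_le_one)
  have "berezin_transform A \<zeta> = of_real (\<phi> \<zeta>)" if "\<zeta> \<in> unit_disc" for \<zeta>
    unfolding \<phi>_def
    by (rule berezin_transform_diagonal_operator[where C = "\<lambda>i. norm (a i)"])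
       (use that cont bound assms(2) in \<open>auto simp: g_def\<close>)
  then have range: "berezin_range A = complex_of_real ` \<phi> ` unit_disc"
    unfolding berezin_range_def image_image by (rule image_cong[OF refl])
  have "continuous_on unit_disc \<phi>"
    unfolding \<phi>_def
    by (intro continuous_intros continuous_on_bergman_inner_normalized_kernel[OF cont bound])
  then have "connected (\<phi> ` unit_disc)"
    by (rule connected_continuous_image) (simp add: unit_disc_def)
  then have "convex (\<phi> ` unit_disc)"
    by (simp add: is_interval_connected_1[symmetric] is_interval_convex_1)
  then show ?thesis
    unfolding range
    by (rule convex_linear_image[OF bounded_linear.linear[OF bounded_linear_of_real]])
qed

end
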